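(* Let $y_1,\dots,y_L\in\mathbb{R}^N$ be such that $\sum_{l=1}^L\mathcal{C}(y_l)^\top\mathcal{C}(y_l)$ is invertible, let $\varepsilon>0$, let $\rho$ be the function on $\mathbb{S}^{N-1}$ defined in the context, and let $h_0\in\mathbb{S}^{N-1}$ be any initial point. For any prescribed tolerances $\epsilon_g>0$ and $\epsilon_H>0$, there exist a gradient descent step size $\alpha_g>0$, a negative-curvature step size $\alpha_H>0$, and a finite integer $T$ of order $O\bigl(\max\{\epsilon_g^{-2},\epsilon_H^{-3}\}\bigr)$ (that is, for $\epsilon_g,\epsilon_H\le 1$, $T\le C\max\{\epsilon_g^{-2},\epsilon_H^{-3}\}$ with $C$ not depending on $\epsilon_g,\epsilon_H$) such that the algorithm RGD-NCS described in the context, run with these parameters, returns within at most $T$ iterations an $(\epsilon_g,\epsilon_H)$-approximate second-order stationary point of the problem $\min_{h\in\mathbb{S}^{N-1}}\rho(h)$, i.e. terminates at a point $\widetilde h\in\mathbb{S}^{N-1}$ with $$\|\mathrm{grad}\,\rho(\widetilde h)\|_2\le\epsilon_g\qquad\text{and}\qquad\lambda_{\min}\bigl(\mathrm{Hess}\,\rho(\widetilde h)\bigr)\ge-\epsilon_H.$$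
   Context: Notation. For $u\in\mathbb{R}^N$, $\mathcal{C}(u)$ is the $N\times N$ circulant matrix with first column $u$, i.e. $\mathcal{C}(u)_{i,j}=u_{((i-j)\bmod N)+1}$. For $n=1,\dots,N$, $\Gamma_n$ is the symmetric $N\times N$ block-diagonal permutation matrix with diagonal blocks $J_n$ and $J_{N-n}$, where $J_m$ is the $m\times m$ reversal matrix (ones on the anti-diagonal, zeros elsewhere; $J_0$ is empty). Put $R=\bigl[\frac1L\sum_{l=1}^L\mathcal{C}(y_l)^\top\mathcal{C}(y_l)\bigr]^{-1/2}$ and $$\rho(h)=\sum_{n=1}^N\Bigl(\tfrac1L\sum_{l=1}^L\bigl|y_l^\top\Gamma_nRh\bigr|^2+\varepsilon\Bigr)^{1/2},\qquad h\in\mathbb{S}^{N-1}=\{h\in\mathbb{R}^N:\|h\|_2=1\}.$$ The sphere carries the metric induced by the Euclidean inner product; with $\nabla,\nabla^2$ the Euclidean gradient and Hessian, $\mathrm{grad}\,\rho(h)=(I-hh^\top)\nabla\rho(h)$ and $\mathrm{Hess}\,\rho(h)=(I-hh^\top)\bigl[\nabla^2\rho(h)-(h^\top\nabla\rho(h))I\bigr](I-hh^\top)$; $\lambda_{\min}(\mathrm{Hess}\,\rho(h))$ denotes the smallest eigenvalue of $\mathrm{Hess}\,\rho(h)$ viewed as a self-adjoint operator on the tangent space $\{v:h^\top v=0\}$ (so $N\ge2$). Algorithm RGD-NCS. Input: $y_1,\dots,y_L$, initial point $h_0\in\mathbb{S}^{N-1}$, tolerances $\epsilon_g,\epsilon_H>0$,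 step sizes $\alpha_g,\alpha_H>0$. For $t=1,2,\dots$: if $\|\mathrm{grad}\,\rho(h_{t-1})\|_2>\epsilon_g$, set $h_t=\frac{h_{t-1}-\alpha_g\mathrm{grad}\,\rho(h_{t-1})}{\|h_{t-1}-\alpha_g\mathrm{grad}\,\rho(h_{t-1})\|_2}$. Otherwise, compute $\lambda_{\min}(\mathrm{Hess}\,\rho(h_{t-1}))$ and an associated unit tangent eigenvector $v_t$; if $\lambda_{\min}(\mathrm{Hess}\,\rho(h_{t-1}))<-\epsilon_H$, choose $\eta_t\in\{1,-1\}$ with $\eta_t\,v_t^\top\mathrm{grad}\,\rho(h_{t-1})\ge0$ and set $h_t=\frac{h_{t-1}-\alpha_H\eta_tv_t}{\|h_{t-1}-\alpha_H\eta_tv_t\|_2}$; else set $\widetilde h=h_{t-1}$ and stop (returning $\widetilde h$, equivalently $R\widetilde h$). *)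

theory Defs
  imports "HOL-Analysis.Analysis"
begin

text \<open>
  The coordinates of a vector in \<open>real ^ 'n\<close> carry no order, whereas circulant and reversal
  matrices need one.  It is supplied by a labelling \<open>ix\<close>, a bijection from the
  index type onto \<open>{1..N}\<close> with \<open>N = CARD('n)\<close>, so that \<open>u $ i\<close> is the
  \<open>ix i\<close>-th coordinate of \<open>u\<close>.
\<close>

definition labelling :: "('n::finite \<Rightarrow> nat) \<Rightarrow> bool" where
  "labelling ix \<longleftrightarrow> bij_betw ix UNIV {1..CARD('n)}"

text \<open>The residue is taken over the integers: natural-number subtraction would truncate.\<close>

definition circulant :: "('n::finite \<Rightarrow> nat) \<Rightarrow> real ^ 'n \<Rightarrow> real ^ 'n ^ 'n" where
  "circulant ix u =
     (\<chi> i j. u $ the_inv ix (nat ((int (ix i) - int (ix j)) mod int CARD('n)) + 1))"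

definition reversal_entry :: "nat \<Rightarrow> nat \<Rightarrow> nat \<Rightarrow> real" where
  "reversal_entry m i j = (if i + j = m + 1 then 1 else 0)"

definition Gamma_mat :: "('n::finite \<Rightarrow> nat) \<Rightarrow> nat \<Rightarrow> real ^ 'n ^ 'n" where
  "Gamma_mat ix n =
     (\<chi> i j.
        if ix i \<le> n \<and> ix j \<le> n then reversal_entry n (ix i) (ix j)
        else if n < ix i \<and> n < ix j then reversal_entry (CARD('n) - n) (ix i - n) (ix j - n)
        else 0)"

definition pos_semidef :: "real ^ 'n ^ 'n \<Rightarrow> bool" where
  "pos_semidef A \<longleftrightarrow> transpose A = A \<and> (\<forall>x. 0 \<le> x \<bullet> (A *v x))"

definition matrix_sqrt :: "real ^ 'n ^ 'n \<Rightarrow> real ^ 'n ^ 'n" where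
  "matrix_sqrt A = (THE S. pos_semidef S \<and> S ** S = A)"

text \<open>The matrix \<open>R\<close>, an inverse square root.\<close>

definition precond ::
  "('n::finite \<Rightarrow> nat) \<Rightarrow> nat \<Rightarrow> (nat \<Rightarrow> real ^ 'n) \<Rightarrow> real ^ 'n ^ 'n" where
  "precond ix L y =
     matrix_inv (matrix_sqrt
       ((1 / real L) *\<^sub>R (\<Sum>l = 1..L. transpose (circulant ix (y l)) ** circulant ix (y l))))"

text \<open>
  \<open>rho\<close> is given by its formula on the whole space, so that Euclidean derivatives make sense;
  the optimization problem only concerns its restriction to the unit sphere.
\<close>

definition rho ::
  "('n::finite \<Rightarrow> nat) \<Rightarrow> nat \<Rightarrow> (nat \<Rightarrow> real ^ 'n) \<Rightarrow> real \<Rightarrow> real ^ 'n \<Rightarrow> real" where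
  "rho ix L y \<epsilon> h =
     (\<Sum>n = 1..CARD('n).
        sqrt ((1 / real L) *
                (\<Sum>l = 1..L. \<bar>y l \<bullet> (Gamma_mat ix n *v (precond ix L y *v h))\<bar>\<^sup>2) + \<epsilon>))"

definition gradient :: "(real ^ 'n \<Rightarrow> real) \<Rightarrow> real ^ 'n \<Rightarrow> real ^ 'n" where
  "gradient f x = (THE D. GDERIV f x :> D)"

definition hessian :: "(real ^ 'n \<Rightarrow> real) \<Rightarrow> real ^ 'n \<Rightarrow> real ^ 'n ^ 'n" where
  "hessian f x = jacobian (gradient f) (at x)"

definition tangent_proj :: "real ^ 'n \<Rightarrow> real ^ 'n ^ 'n" where
  "tangent_proj h = mat 1 - (columnvector h :: real ^ 1 ^ 'n) ** (rowvector h :: real ^ 'n ^ 1)"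

definition rgrad :: "(real ^ 'n \<Rightarrow> real) \<Rightarrow> real ^ 'n \<Rightarrow> real ^ 'n" where
  "rgrad f h = tangent_proj h *v gradient f h"

definition rhess :: "(real ^ 'n \<Rightarrow> real) \<Rightarrow> real ^ 'n \<Rightarrow> real ^ 'n ^ 'n" where
  "rhess f h =
     tangent_proj h ** (hessian f h - (h \<bullet> gradient f h) *\<^sub>R mat 1) ** tangent_proj h"

text \<open>
  Eigenvalues on the tangent space only: on the whole space \<open>rhess f h\<close> would have the additional
  eigenvalue \<open>0\<close> with eigenvector \<open>h\<close>.
\<close>

definition tangent_eigenvalues :: "real ^ 'n ^ 'n \<Rightarrow> real ^ 'n \<Rightarrow> real set" where
  "tangent_eigenvalues A h = {c. \<exists>v. v \<noteq> 0 \<and> h \<bullet> v = 0 \<and> A *v v = c *\<^sub>R v}"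

definition rhess_min_eigenvalue :: "(real ^ 'n \<Rightarrow> real) \<Rightarrow> real ^ 'n \<Rightarrow> real" where
  "rhess_min_eigenvalue f h = Min (tangent_eigenvalues (rhess f h) h)"

definition normalize_vec :: "real ^ 'n \<Rightarrow> real ^ 'n" where
  "normalize_vec x = x /\<^sub>R norm x"

text \<open>
  One iteration of the algorithm, for an arbitrary objective \<open>f\<close>.  It is a relation because the
  unit eigenvector \<open>v\<close> and the sign \<open>\<eta>\<close> are not determined uniquely.
\<close>

datatype 'v rgd_state = Running 'v | Returned 'v

inductive rgd_step ::
  "(real ^ 'n \<Rightarrow> real) \<Rightarrow> real \<Rightarrow> real \<Rightarrow> real \<Rightarrow> real \<Rightarrow>
   (real ^ 'n) rgd_state \<Rightarrow> (real ^ 'n) rgd_state \<Rightarrow> bool"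
  for f \<epsilon>g \<epsilon>H \<alpha>g \<alpha>H
where
  gradient_step:
    "norm (rgrad f h) > \<epsilon>g \<Longrightarrow>
     rgd_step f \<epsilon>g \<epsilon>H \<alpha>g \<alpha>H (Running h) (Running (normalize_vec (h - \<alpha>g *\<^sub>R rgrad f h)))"
| curvature_step:
    "\<not> norm (rgrad f h) > \<epsilon>g \<Longrightarrow>
     rhess_min_eigenvalue f h < - \<epsilon>H \<Longrightarrow>
     norm v = 1 \<Longrightarrow> h \<bullet> v = 0 \<Longrightarrow> rhess f h *v v = rhess_min_eigenvalue f h *\<^sub>R v \<Longrightarrow>
     \<eta> \<in> {1, -1} \<Longrightarrow> \<eta> * (v \<bullet> rgrad f h) \<ge> 0 \<Longrightarrow>
     rgd_step f \<epsilon>g \<epsilon>H \<alpha>g \<alpha>H (Running h) (Running (normalize_vec (h - (\<alpha>H * \<eta>) *\<^sub>R v)))"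
| stop:
    "\<not> norm (rgrad f h) > \<epsilon>g \<Longrightarrow>
     \<not> rhess_min_eigenvalue f h < - \<epsilon>H \<Longrightarrow>
     rgd_step f \<epsilon>g \<epsilon>H \<alpha>g \<alpha>H (Running h) (Returned h)"

text \<open>
  Total correctness for all admissible choices of \<open>v\<close> and \<open>\<eta>\<close>: no execution is longer than
  \<open>T\<close> iterations (the stopping one included), none gets stuck before returning, and each
  returned point satisfies \<open>P\<close>.
\<close>

definition rgd_returns_within ::
  "(real ^ 'n \<Rightarrow> real) \<Rightarrow> real \<Rightarrow> real \<Rightarrow> real \<Rightarrow> real \<Rightarrow> real ^ 'n \<Rightarrow> nat \<Rightarrow>
   (real ^ 'n \<Rightarrow> bool) \<Rightarrow> bool" where
  "rgd_returns_within f \<epsilon>g \<epsilon>H \<alpha>g \<alpha>H h\<^sub>0 T P \<longleftrightarrow>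
     (\<forall>k s. (rgd_step f \<epsilon>g \<epsilon>H \<alpha>g \<alpha>H ^^ k) (Running h\<^sub>0) s \<longrightarrow>
        k \<le> T \<and>
        (case s of
           Running h \<Rightarrow> \<exists>s'. rgd_step f \<epsilon>g \<epsilon>H \<alpha>g \<alpha>H (Running h) s'
         | Returned h \<Rightarrow> P h))"

definition approx_second_order_stationary ::
  "(real ^ 'n \<Rightarrow> real) \<Rightarrow> real \<Rightarrow> real \<Rightarrow> real ^ 'n \<Rightarrow> bool" where
  "approx_second_order_stationary f \<epsilon>g \<epsilon>H h \<longleftrightarrow>
     h \<in> sphere 0 1 \<and> norm (rgrad f h) \<le> \<epsilon>g \<and> rhess_min_eigenvalue f h \<ge> - \<epsilon>H"

end

theory Submission
  imports Defs
begin

text \<open>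
  Each summand of \<open>rho\<close> is \<open>sqrt (x \<bullet> B x + \<epsilon>)\<close> with a positive semidefinite matrix \<open>B\<close>.
  Both kinds of steps move from a unit vector \<open>h\<close> to the normalization of \<open>h + t v\<close> for a unit
  tangent vector \<open>v\<close>, and along this curve the quadratic form is the rational function
  \<open>(a + 2 b t + c t\<^sup>2) / (1 + t\<^sup>2)\<close> with \<open>a = h \<bullet> B h\<close>, \<open>b = v \<bullet> B h\<close>, \<open>c = v \<bullet> B v\<close>.  The Taylor
  polynomials of odd degree of the square root lie above it, by a polynomial identity.  Those of
  degree one and three, expanded at the value of the summand at \<open>h\<close>, therefore bound \<open>rho\<close> from
  above by its first-order expansion plus \<open>K\<^sub>g t\<^sup>2\<close> (lemma \<open>sqrt_form_first_order\<close>), and for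
  \<open>t \<le> 1\<close> by its second-order expansion plus \<open>K\<^sub>H t\<^sup>3\<close> (lemma \<open>sqrt_form_second_order\<close>).  The
  coefficients that appear are the Riemannian gradient and Hessian, because the curve has
  acceleration \<open>- h\<close> at \<open>t = 0\<close>.  As \<open>\<epsilon> > 0\<close> keeps the roots away from zero, the two constants
  are the same for all \<open>h\<close> and \<open>v\<close>.

  These bounds give the complexity in the usual way.  With step size \<open>1 / (2 K\<^sub>g)\<close> a gradient
  step lowers \<open>rho\<close> by at least \<open>\<epsilon>g\<^sup>2 / (4 K\<^sub>g)\<close>.  A curvature step of length \<open>t\<close> gains
  \<open>\<epsilon>H t\<^sup>2 / 2\<close> from the quadratic term, the sign choice makes the linear term harmless, and for
  \<open>t\<close> of order \<open>\<epsilon>H\<close> the cubic error eats at most half of the gain, so that a decrease of order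
  \<open>\<epsilon>H\<^sup>3\<close> remains.  Since \<open>rho\<close> is nonnegative, the number of steps is at most the initial value
  divided by the smaller decrease, plus the stopping step (theorem \<open>rgd_complexity\<close>).  The
  iteration never gets stuck because the Riemannian Hessian, a self-adjoint operator on the
  tangent space, has a smallest eigenvalue with an eigenvector
  (lemma \<open>rhess_min_eigenvector_exists\<close>).
\<close>

section \<open>Smallest eigenvalue on the tangent space\<close>

lemma tangent_proj_mult:
  fixes h w :: "real ^ 'n"
  shows "tangent_proj h *v w = w - (h \<bullet> w) *\<^sub>R h"
proof -
  have "((columnvector h :: real ^ 1 ^ 'n) ** (rowvector h :: real ^ 'n ^ 1)) *v w = (h \<bullet> w) *\<^sub>R h"
    by (simp add: vec_eq_iff matrix_vector_mult_def matrix_matrix_mult_def columnvector_def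
        rowvector_def inner_vec_def sum_distrib_left mult_ac)
  then show ?thesis by (simp add: tangent_proj_def matrix_vector_mult_diff_rdistrib)
qed

lemma symmetric_matrix_inner_commute:
  fixes A :: "real ^ 'n ^ 'n"
  assumes "transpose A = A"
  shows "u \<bullet> (A *v w) = w \<bullet> (A *v u)"
  by (metis assms dot_lmul_matrix inner_commute transpose_matrix_vector)

text \<open>
  Eigenvectors of a symmetric matrix for distinct eigenvalues are orthogonal, hence independent.
  Finiteness and nonemptiness of the set of eigenvalues are what makes its \<open>Min\<close> meaningful.
\<close>

lemma tangent_eigenvalues_finite:
  fixes A :: "real ^ 'n ^ 'n"
  assumes sym: "\<And>u w. u \<bullet> (A *v w) = w \<bullet> (A *v u)"
  shows "finite (tangent_eigenvalues A h)"
proof -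
  define S where "S = tangent_eigenvalues A h"
  have "\<forall>c\<in>S. \<exists>v. v \<noteq> 0 \<and> A *v v = c *\<^sub>R v"
    by (auto simp: S_def tangent_eigenvalues_def)
  then obtain e where e: "\<And>c. c \<in> S \<Longrightarrow> e c \<noteq> 0 \<and> A *v e c = c *\<^sub>R e c" by metis
  have orth: "e c \<bullet> e d = 0" if "c \<in> S" "d \<in> S" "c \<noteq> d" for c d
  proof -
    have "d * (e c \<bullet> e d) = c * (e c \<bullet> e d)"
      using sym[of "e c" "e d"] e[OF that(1)] e[OF that(2)] by (simp add: inner_commute)
    then show ?thesis using that(3) by simp
  qed
  have "inj_on e S"
  proof (rule inj_onI, rule ccontr)
    fix c d assume "c \<in> S" "d \<in> S" "e c = e d" "c \<noteq> d"
    then show False using orth[of c d] e[of d] by simp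
  qed
  moreover have "pairwise orthogonal (e ` S)"
    using orth by (auto simp: pairwise_def orthogonal_def)
  then have "independent (e ` S)"
    using e by (intro pairwise_orthogonal_independent) auto
  then have "finite (e ` S)" by (rule independent_imp_finite)
  ultimately show ?thesis using finite_imageD S_def by blast
qed

text \<open>
  A minimizer of the quadratic form over the unit tangent vectors is an eigenvector: otherwise
  moving it against the residual \<open>r = A x - c x\<close> would lower the form below \<open>c\<close> times the squared
  norm.
\<close>

lemma tangent_eigenvalue_exists:
  fixes A :: "real ^ 'n ^ 'n"
  assumes sym: "\<And>u w. u \<bullet> (A *v w) = w \<bullet> (A *v u)"
    and tangent: "\<And>w. h \<bullet> w = 0 \<Longrightarrow> h \<bullet> (A *v w) = 0"
    and dim: "CARD('n) \<ge> 2"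
  shows "tangent_eigenvalues A h \<noteq> {}"
proof -
  define S where "S = {w. h \<bullet> w = 0} \<inter> sphere 0 1"
  obtain u where "u \<noteq> 0" "orthogonal h u"
    using orthogonal_to_vector_exists[of h] dim by (auto simp: orthogonal_commute)
  then have "u /\<^sub>R norm u \<in> S"
    by (auto simp: S_def orthogonal_def)
  then have "S \<noteq> {}" by auto
  moreover have "compact S"
    unfolding S_def by (intro closed_Int_compact closed_hyperplane compact_sphere)
  moreover have "continuous_on S (\<lambda>w. w \<bullet> (A *v w))"
    by (intro continuous_intros matrix_vector_mult_linear_continuous_on)
  ultimately obtain x where x: "x \<in> S" and min: "\<And>w. w \<in> S \<Longrightarrow> x \<bullet> (A *v x) \<le> w \<bullet> (A *v w)"
    using continuous_attains_inf by metis
  define c where "c = x \<bullet> (A *v x)"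
  define q where "q = (\<lambda>w. w \<bullet> (A *v w) - c * (w \<bullet> w))"
  have xx: "x \<bullet> x = 1" "h \<bullet> x = 0" "x \<noteq> 0"
    using x by (auto simp: S_def dot_square_norm)
  have qpos: "q w \<ge> 0" if "h \<bullet> w = 0" for w
  proof (cases "w = 0")
    case False
    have "w /\<^sub>R norm w \<in> S" using False that by (auto simp: S_def)
    from min[OF this] have "c \<le> (w \<bullet> (A *v w)) / (norm w)\<^sup>2"
      by (simp add: c_def matrix_vector_mult_scaleR power2_eq_square divide_simps)
    then show ?thesis using False
      by (simp add: q_def divide_simps dot_square_norm)
  qed (simp add: q_def)
  define r where "r = A *v x - c *\<^sub>R x"
  have hr: "h \<bullet> r = 0" using tangent[OF xx(2)] xx(2) by (simp add: r_def inner_diff_right)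
  have expand: "q (x + t *\<^sub>R r) = 2 * t * (r \<bullet> r) + t\<^sup>2 * q r" for t
    using sym[of x r] xx(1) c_def
    unfolding q_def
    by (simp add: r_def inner_commute matrix_vector_right_distrib matrix_vector_mult_scaleR inner_simps
        algebra_simps power2_eq_square)
  have "r \<bullet> r = 0"
  proof (rule ccontr)
    assume nz: "r \<bullet> r \<noteq> 0"
    then have pos: "r \<bullet> r > 0" using inner_ge_zero[of r] by linarith
    \<comment> \<open>Adding \<open>1\<close> keeps the denominator positive and makes \<open>t\<close> small enough for the linear term to win.\<close>
    define t where "t = - (r \<bullet> r) / (q r + 1)"
    have q1: "q r + 1 > 0" using qpos[OF hr] by simp
    have "q (x + t *\<^sub>R r) = t * (2 * (r \<bullet> r) + t * q r)"
      by (simp add: expand algebra_simps power2_eq_square)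
    moreover have "2 * (r \<bullet> r) + t * q r > 0"
    proof -
      have "- t * q r \<le> r \<bullet> r"
        using q1 pos qpos[OF hr] by (simp add: t_def field_simps)
      then show ?thesis using pos by linarith
    qed
    moreover have "t < 0" using pos q1 by (simp add: t_def)
    ultimately have "q (x + t *\<^sub>R r) < 0" by (simp add: mult_neg_pos)
    moreover have "h \<bullet> (x + t *\<^sub>R r) = 0" using hr xx by (simp add: inner_add_right)
    ultimately show False using qpos by fastforce
  qed
  then have "A *v x = c *\<^sub>R x" by (simp add: r_def)
  then show ?thesis using xx by (auto simp: tangent_eigenvalues_def)
qed

lemma rhess_mult:
  "rhess f h *v w = tangent_proj h *v
     (hessian f h *v (tangent_proj h *v w) - (h \<bullet> gradient f h) *\<^sub>R (tangent_proj h *v w))"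
  unfolding rhess_def
  by (simp add: matrix_vector_mul_assoc[symmetric] matrix_vector_mult_diff_rdistrib
     scaleR_matrix_vector_assoc[symmetric])

lemma rhess_symmetric:
  assumes "\<And>u w. u \<bullet> (hessian f h *v w) = w \<bullet> (hessian f h *v u)"
  shows "u \<bullet> (rhess f h *v w) = w \<bullet> (rhess f h *v u)"
proof -
  have P: "u \<bullet> (tangent_proj h *v w) = (tangent_proj h *v u) \<bullet> w" for u w :: "real ^ 'a"
    by (simp add: tangent_proj_mult inner_simps inner_commute)
  show ?thesis
    unfolding rhess_mult P
    using assms by (simp add: inner_diff_right inner_commute)
qed

lemma rhess_tangent: "norm h = 1 \<Longrightarrow> h \<bullet> (rhess f h *v w) = 0"
  unfolding rhess_mult tangent_proj_mult[of h "_ - _"] by (simp add: inner_diff_right dot_square_norm)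

lemma rhess_min_eigenvector_exists:
  fixes f :: "real ^ 'n \<Rightarrow> real"
  assumes "\<And>u w. u \<bullet> (hessian f h *v w) = w \<bullet> (hessian f h *v u)"
    and "norm h = 1" "CARD('n) \<ge> 2"
  obtains v where "norm v = 1" "h \<bullet> v = 0" "rhess f h *v v = rhess_min_eigenvalue f h *\<^sub>R v"
proof -
  note sym = rhess_symmetric[OF assms(1)]
  have "rhess_min_eigenvalue f h \<in> tangent_eigenvalues (rhess f h) h"
    unfolding rhess_min_eigenvalue_def
    using tangent_eigenvalues_finite[OF sym]
      tangent_eigenvalue_exists[OF sym rhess_tangent[OF assms(2)] assms(3)]
    by (intro Min_in)
  then obtain w where w: "w \<noteq> 0" "h \<bullet> w = 0" "rhess f h *v w = rhess_min_eigenvalue f h *\<^sub>R w"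
    by (auto simp: tangent_eigenvalues_def)
  show ?thesis
    by (rule that[of "w /\<^sub>R norm w"]) (use w in \<open>auto simp: matrix_vector_mult_scaleR\<close>)
qed

section \<open>Iteration complexity from descent along retractions\<close>

lemma norm_tangent_step:
  fixes h v :: "real ^ 'n"
  assumes "norm h = 1" "norm v = 1" "h \<bullet> v = 0"
  shows "(norm (h + t *\<^sub>R v))\<^sup>2 = 1 + t\<^sup>2"
proof -
  have "h \<bullet> h = 1" "v \<bullet> v = 1" "v \<bullet> h = 0"
    using assms by (auto simp: dot_square_norm inner_commute)
  then show ?thesis
    using assms unfolding power2_norm_eq_inner
    by (simp add: inner_add_left inner_add_right power2_eq_square)
qed

lemma norm_normalize_tangent_step:
  fixes h v :: "real ^ 'n"
  assumes "norm h = 1" "norm v = 1" "h \<bullet> v = 0"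
  shows "norm (normalize_vec (h + t *\<^sub>R v)) = 1"
proof -
  have "(norm (h + t *\<^sub>R v))\<^sup>2 > 0"
    unfolding norm_tangent_step[OF assms] by (simp add: add_pos_nonneg)
  then show ?thesis by (auto simp: normalize_vec_def)
qed

text \<open>
  The objective is only required to lie below its Taylor expansions along the curves followed by
  the algorithm, up to uniform error constants.  The expansions are written with the Euclidean
  derivatives: on a tangent vector \<open>v\<close> they agree with the Riemannian ones, where the radial
  derivative \<open>h \<bullet> gradient f h\<close> in the quadratic term comes from the acceleration \<open>- h\<close> of the
  normalized curve.  The constants are at least \<open>1\<close> so that they can be divided by, and so that
  \<open>\<epsilon>H / (4 K\<^sub>H)\<close> is a step length below \<open>1\<close> whenever \<open>\<epsilon>H \<le> 1\<close>.
\<close>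

locale retraction_descent =
  fixes f :: "real ^ 'n \<Rightarrow> real" and m K\<^sub>g K\<^sub>H :: real
  assumes dim: "CARD('n) \<ge> 2"
    and hessian_symmetric: "norm h = 1 \<Longrightarrow> u \<bullet> (hessian f h *v w) = w \<bullet> (hessian f h *v u)"
    and lower: "norm h = 1 \<Longrightarrow> m \<le> f h"
    and K\<^sub>g: "K\<^sub>g \<ge> 1"
    and K\<^sub>H: "K\<^sub>H \<ge> 1"
    and first_order: "\<lbrakk>norm h = 1; norm v = 1; h \<bullet> v = 0; 0 \<le> t\<rbrakk> \<Longrightarrow>
        f (normalize_vec (h + t *\<^sub>R v)) \<le> f h + t * (v \<bullet> gradient f h) + K\<^sub>g * t\<^sup>2"
    and second_order: "\<lbrakk>norm h = 1; norm v = 1; h \<bullet> v = 0; 0 \<le> t; t \<le> 1\<rbrakk> \<Longrightarrow>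
        f (normalize_vec (h + t *\<^sub>R v)) \<le> f h + t * (v \<bullet> gradient f h)
          + t\<^sup>2 / 2 * (v \<bullet> (hessian f h *v v) - h \<bullet> gradient f h) + K\<^sub>H * t ^ 3"
begin

lemma rgrad_tangent: "norm h = 1 \<Longrightarrow> h \<bullet> rgrad f h = 0"
  by (simp add: rgrad_def tangent_proj_mult inner_diff_right dot_square_norm)

lemma inner_rgrad: "h \<bullet> v = 0 \<Longrightarrow> v \<bullet> rgrad f h = v \<bullet> gradient f h"
  by (simp add: rgrad_def tangent_proj_mult inner_diff_right inner_commute)

lemma inner_rhess:
  assumes "norm v = 1" "h \<bullet> v = 0"
  shows "v \<bullet> (rhess f h *v v) = v \<bullet> (hessian f h *v v) - h \<bullet> gradient f h"
proof -
  have "tangent_proj h *v v = v" by (simp add: tangent_proj_mult assms)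
  moreover have "v \<bullet> (tangent_proj h *v w) = v \<bullet> w" for w
    using assms by (simp add: tangent_proj_mult inner_diff_right inner_commute)
  ultimately show ?thesis
    using assms by (simp add: rhess_mult inner_diff_right dot_square_norm)
qed

text \<open>
  In the direction \<open>- rgrad f h\<close> of norm \<open>G\<close> the first-order bound is \<open>f h - t G + K\<^sub>g t\<^sup>2\<close>, and the
  step size is chosen to make \<open>t\<close> its minimizer \<open>G / (2 K\<^sub>g)\<close>.
\<close>

lemma gradient_step_descent:
  assumes h: "norm h = 1" and g: "rgrad f h \<noteq> 0"
  defines "h' \<equiv> normalize_vec (h - (1 / (2 * K\<^sub>g)) *\<^sub>R rgrad f h)"
  shows "norm h' = 1" and "f h' \<le> f h - (norm (rgrad f h))\<^sup>2 / (4 * K\<^sub>g)"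
proof -
  define G where "G = norm (rgrad f h)"
  define v where "v = - (rgrad f h /\<^sub>R G)"
  define t where "t = G / (2 * K\<^sub>g)"
  have G: "G > 0" using g by (simp add: G_def)
  have v: "norm v = 1" "h \<bullet> v = 0"
    using G rgrad_tangent[OF h] by (auto simp: v_def G_def)
  have h': "h' = normalize_vec (h + t *\<^sub>R v)"
    using G by (simp add: h'_def t_def v_def)
  show "norm h' = 1" unfolding h' by (rule norm_normalize_tangent_step[OF h v])
  have "v \<bullet> gradient f h = v \<bullet> rgrad f h" by (simp add: inner_rgrad[OF v(2)])
  also have "\<dots> = - G"
    using G by (simp add: v_def dot_square_norm power2_eq_square flip: G_def)
  finally have "v \<bullet> gradient f h = - G" .
  then have "f h' \<le> f h - t * G + K\<^sub>g * t\<^sup>2"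
    using first_order[OF h v, of t] G K\<^sub>g unfolding h' by (simp add: t_def)
  also have "f h - t * G + K\<^sub>g * t\<^sup>2 = f h - G\<^sup>2 / (4 * K\<^sub>g)"
    using K\<^sub>g by (simp add: t_def field_simps power2_eq_square)
  finally show "f h' \<le> f h - (norm (rgrad f h))\<^sup>2 / (4 * K\<^sub>g)" by (simp add: G_def)
qed

text \<open>
  The sign \<open>\<eta>\<close> makes the direction \<open>- \<eta> v\<close> a non-ascent direction, so only the quadratic gain
  \<open>\<epsilon>H t\<^sup>2 / 2\<close> and the cubic error count; the bound on \<open>t\<close> keeps the error below half of the gain.
\<close>

lemma curvature_step_descent:
  assumes h: "norm h = 1" and v: "norm v = 1" "h \<bullet> v = 0"
    and eig: "rhess f h *v v = c *\<^sub>R v" and c: "c \<le> - \<epsilon>H"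
    and \<eta>: "\<eta> \<in> {1, -1}" "\<eta> * (v \<bullet> rgrad f h) \<ge> 0"
    and t: "0 \<le> t" "t \<le> 1" "4 * K\<^sub>H * t \<le> \<epsilon>H"
  defines "h' \<equiv> normalize_vec (h - (t * \<eta>) *\<^sub>R v)"
  shows "norm h' = 1" and "f h' \<le> f h - \<epsilon>H * t\<^sup>2 / 4"
proof -
  define w where "w = (- \<eta>) *\<^sub>R v"
  have w: "norm w = 1" "h \<bullet> w = 0" using v \<eta> by (auto simp: w_def)
  have h': "h' = normalize_vec (h + t *\<^sub>R w)" by (simp add: h'_def w_def)
  show "norm h' = 1" unfolding h' by (rule norm_normalize_tangent_step[OF h w])
  have "rhess f h *v w = c *\<^sub>R w"
    unfolding w_def matrix_vector_mult_scaleR eig by (simp add: mult.commute)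
  then have quad: "w \<bullet> (hessian f h *v w) - h \<bullet> gradient f h = c"
    using inner_rhess[OF w] w by (simp add: dot_square_norm)
  have "w \<bullet> gradient f h \<le> 0"
    using \<eta>(2) inner_rgrad[OF v(2)] by (simp add: w_def)
  then have lin: "t * (w \<bullet> gradient f h) \<le> 0" using t by (simp add: mult_nonneg_nonpos)
  have "t\<^sup>2 / 2 * c \<le> t\<^sup>2 / 2 * (- \<epsilon>H)" using c by (intro mult_left_mono) auto
  moreover have "K\<^sub>H * t ^ 3 \<le> \<epsilon>H * t\<^sup>2 / 4"
    using mult_right_mono[OF t(3), of "t\<^sup>2"] by (simp add: power2_eq_square power3_eq_cube)
  ultimately show "f h' \<le> f h - \<epsilon>H * t\<^sup>2 / 4"
    using second_order[OF h w t(1,2)] lin unfolding h' quad by (simp add: mult.commute)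
qed

lemma rgd_step_exists:
  assumes "norm h = 1"
  shows "\<exists>s. rgd_step f \<epsilon>g \<epsilon>H \<alpha>g \<alpha>H (Running h) s"
proof -
  obtain v where v: "norm v = 1" "h \<bullet> v = 0" "rhess f h *v v = rhess_min_eigenvalue f h *\<^sub>R v"
    using rhess_min_eigenvector_exists[OF hessian_symmetric[OF assms] assms dim] by blast
  define \<eta> :: real where "\<eta> = (if v \<bullet> rgrad f h \<ge> 0 then 1 else -1)"
  have \<eta>: "\<eta> \<in> {1, -1}" "\<eta> * (v \<bullet> rgrad f h) \<ge> 0" by (auto simp: \<eta>_def)
  show ?thesis
    using rgd_step.gradient_step rgd_step.stop rgd_step.curvature_step[OF _ _ v \<eta>] by metis
qed

text \<open>
  The potential argument.  The stopping step moves no point and thus costs no decrease, which is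
  why one step fewer is charged to a returned state.
\<close>

lemma rgd_reachable:
  fixes \<epsilon>g \<epsilon>H t \<delta> :: real
  assumes h\<^sub>0: "norm h\<^sub>0 = 1"
    and \<epsilon>g: "\<epsilon>g > 0"
    and t: "0 \<le> t" "t \<le> 1" "4 * K\<^sub>H * t \<le> \<epsilon>H"
    and \<delta>: "\<delta> \<le> \<epsilon>g\<^sup>2 / (4 * K\<^sub>g)" "\<delta> \<le> \<epsilon>H * t\<^sup>2 / 4"
    and steps: "(rgd_step f \<epsilon>g \<epsilon>H (1 / (2 * K\<^sub>g)) t ^^ k) (Running h\<^sub>0) s"
  shows "case s of
      Running h \<Rightarrow> norm h = 1 \<and> f h + real k * \<delta> \<le> f h\<^sub>0
    | Returned h \<Rightarrow> approx_second_order_stationary f \<epsilon>g \<epsilon>H h \<and> f h + (real k - 1) * \<delta> \<le> f h\<^sub>0"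
  using steps
proof (induction k arbitrary: s)
  case 0
  then have "s = Running h\<^sub>0" by simp
  then show ?case using h\<^sub>0 by simp
next
  case (Suc k)
  from Suc.prems obtain s' where s': "(rgd_step f \<epsilon>g \<epsilon>H (1 / (2 * K\<^sub>g)) t ^^ k) (Running h\<^sub>0) s'"
    and step: "rgd_step f \<epsilon>g \<epsilon>H (1 / (2 * K\<^sub>g)) t s' s" by auto
  from step show ?case
  proof cases
    case (gradient_step h)
    then have IH: "norm h = 1" "f h + real k * \<delta> \<le> f h\<^sub>0" using Suc.IH[OF s'] by simp_all
    have "\<epsilon>g\<^sup>2 \<le> (norm (rgrad f h))\<^sup>2" using gradient_step(3) \<epsilon>g by (intro power_mono) auto
    then have decrease: "\<epsilon>g\<^sup>2 / (4 * K\<^sub>g) \<le> (norm (rgrad f h))\<^sup>2 / (4 * K\<^sub>g)"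
      using K\<^sub>g by (intro divide_right_mono) auto
    have "rgrad f h \<noteq> 0" using gradient_step(3) \<epsilon>g by fastforce
    note descent = gradient_step_descent[OF IH(1) this]
    have "f (normalize_vec (h - (1 / (2 * K\<^sub>g)) *\<^sub>R rgrad f h)) + \<delta> \<le> f h"
      using decrease descent(2) \<delta>(1) by linarith
    then show ?thesis using IH(2) descent(1) unfolding gradient_step(2) by (simp add: distrib_right)
  next
    case (curvature_step h v \<eta>)
    then have IH: "norm h = 1" "f h + real k * \<delta> \<le> f h\<^sub>0" using Suc.IH[OF s'] by simp_all
    have "rhess_min_eigenvalue f h \<le> - \<epsilon>H" using curvature_step(4) by simp
    note descent = curvature_step_descent[OF IH(1) curvature_step(5-7) this curvature_step(8,9) t]
    have "f (normalize_vec (h - (t * \<eta>) *\<^sub>R v)) + \<delta> \<le> f h"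
      using descent(2) \<delta>(2) by linarith
    then show ?thesis using IH(2) descent(1) unfolding curvature_step(2) by (simp add: distrib_right)
  next
    case (stop h)
    then have IH: "norm h = 1" "f h + real k * \<delta> \<le> f h\<^sub>0" using Suc.IH[OF s'] by simp_all
    then show ?thesis using stop(3,4) unfolding stop(2)
      by (simp add: approx_second_order_stationary_def)
  qed
qed

theorem rgd_complexity:
  assumes h\<^sub>0: "norm h\<^sub>0 = 1"
  shows "\<exists>C>0. \<forall>\<epsilon>g>0. \<forall>\<epsilon>H>0. \<exists>\<alpha>g>0. \<exists>\<alpha>H>0. \<exists>T::nat.
           (\<epsilon>g \<le> 1 \<and> \<epsilon>H \<le> 1 \<longrightarrow> real T \<le> C * max (1 / \<epsilon>g ^ 2) (1 / \<epsilon>H ^ 3)) \<and>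
           rgd_returns_within f \<epsilon>g \<epsilon>H \<alpha>g \<alpha>H h\<^sub>0 T (approx_second_order_stationary f \<epsilon>g \<epsilon>H)"
proof -
  define \<Delta> where "\<Delta> = f h\<^sub>0 - m"
  define c where "c = max (4 * K\<^sub>g) (64 * K\<^sub>H\<^sup>2)"
  define C where "C = \<Delta> * c + 1"
  have \<Delta>: "\<Delta> \<ge> 0" using lower[OF h\<^sub>0] by (simp add: \<Delta>_def)
  have c: "c > 0" using K\<^sub>g by (simp add: c_def less_max_iff_disj)
  have C: "C > 0" using \<Delta> c by (simp add: C_def add_nonneg_pos)
  show ?thesis
  proof (rule exI[of _ C], intro conjI allI impI)
    show "C > 0" by (rule C)
  next
    fix \<epsilon>g \<epsilon>H :: real assume eps: "\<epsilon>g > 0" "\<epsilon>H > 0"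
    \<comment> \<open>The cap at \<open>1\<close>, where the second-order bound ends, is active only for large \<open>\<epsilon>H\<close>.\<close>
    define t where "t = min 1 (\<epsilon>H / (4 * K\<^sub>H))"
    define \<delta> where "\<delta> = min (\<epsilon>g\<^sup>2 / (4 * K\<^sub>g)) (\<epsilon>H * t\<^sup>2 / 4)"
    define T where "T = nat \<lfloor>\<Delta> / \<delta>\<rfloor> + 1"
    have t: "0 < t" "t \<le> 1" using K\<^sub>H eps by (auto simp: t_def)
    have "t \<le> \<epsilon>H / (4 * K\<^sub>H)" by (simp add: t_def)
    then have tH: "4 * K\<^sub>H * t \<le> \<epsilon>H" using K\<^sub>H by (simp add: field_simps)
    have \<delta>: "\<delta> > 0" using K\<^sub>g eps t by (simp add: \<delta>_def)
    have bound: "real T \<le> C * max (1 / \<epsilon>g ^ 2) (1 / \<epsilon>H ^ 3)" if le1: "\<epsilon>g \<le> 1" "\<epsilon>H \<le> 1"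
    proof -
      define M where "M = max (1 / \<epsilon>g ^ 2) (1 / \<epsilon>H ^ 3)"
      have M1: "1 \<le> M" using eps le1 by (simp add: M_def le_max_iff_disj power_le_one)
      have "\<epsilon>H \<le> 4 * K\<^sub>H" using le1 K\<^sub>H by simp
      then have "t = \<epsilon>H / (4 * K\<^sub>H)" using K\<^sub>H by (simp add: t_def min_def)
      then have tt: "\<epsilon>H * t\<^sup>2 / 4 = \<epsilon>H ^ 3 / (64 * K\<^sub>H\<^sup>2)"
        by (simp add: power2_eq_square power3_eq_cube)
      have "1 / \<delta> \<le> c * M"
      proof -
        have "4 * K\<^sub>g * (1 / \<epsilon>g\<^sup>2) \<le> c * M" "64 * K\<^sub>H\<^sup>2 * (1 / \<epsilon>H ^ 3) \<le> c * M"
          using eps K\<^sub>g c by (intro mult_mono; simp add: c_def M_def le_max_iff_disj)+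
        moreover have "1 / \<delta> = 4 * K\<^sub>g * (1 / \<epsilon>g\<^sup>2) \<or> 1 / \<delta> = 64 * K\<^sub>H\<^sup>2 * (1 / \<epsilon>H ^ 3)"
          unfolding \<delta>_def tt by (simp add: min_def)
        ultimately show ?thesis by auto
      qed
      then have "\<Delta> / \<delta> \<le> \<Delta> * c * M" using mult_left_mono[OF _ \<Delta>] by (fastforce simp: mult.assoc)
      moreover have "real T \<le> \<Delta> / \<delta> + 1" using \<Delta> \<delta> by (simp add: T_def)
      ultimately show ?thesis using M1 unfolding M_def[symmetric] C_def by (simp add: algebra_simps)
    qed
    have "rgd_returns_within f \<epsilon>g \<epsilon>H (1 / (2 * K\<^sub>g)) t h\<^sub>0 T (approx_second_order_stationary f \<epsilon>g \<epsilon>H)"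
      unfolding rgd_returns_within_def
    proof (intro allI impI)
      fix k s assume "(rgd_step f \<epsilon>g \<epsilon>H (1 / (2 * K\<^sub>g)) t ^^ k) (Running h\<^sub>0) s"
      then have inv: "case s of
            Running h \<Rightarrow> norm h = 1 \<and> f h + real k * \<delta> \<le> f h\<^sub>0
          | Returned h \<Rightarrow> approx_second_order_stationary f \<epsilon>g \<epsilon>H h \<and> f h + (real k - 1) * \<delta> \<le> f h\<^sub>0"
        using t eps by (intro rgd_reachable[OF h\<^sub>0 eps(1) _ t(2) tH]) (auto simp: \<delta>_def)
      obtain h where h: "norm h = 1" "f h + (real k - 1) * \<delta> \<le> f h\<^sub>0"
      proof (cases s)
        case (Running h)
        then show ?thesis using inv that[of h] \<delta> by (simp add: algebra_simps)
      next
        case (Returned h)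
        then show ?thesis using inv that[of h] by (simp add: approx_second_order_stationary_def)
      qed
      have "(real k - 1) * \<delta> \<le> \<Delta>" using h lower[OF h(1)] by (simp add: \<Delta>_def)
      then have "real k - 1 \<le> \<Delta> / \<delta>" using \<delta> by (simp add: field_simps)
      then have "int k - 1 \<le> \<lfloor>\<Delta> / \<delta>\<rfloor>" by (simp add: le_floor_iff)
      then have "k \<le> T" by (simp add: T_def)
      then show "k \<le> T \<and> (case s of
           Running h \<Rightarrow> \<exists>s'. rgd_step f \<epsilon>g \<epsilon>H (1 / (2 * K\<^sub>g)) t (Running h) s'
         | Returned h \<Rightarrow> approx_second_order_stationary f \<epsilon>g \<epsilon>H h)"
        using inv rgd_step_exists by (auto split: rgd_state.split)
    qed
    then show "\<exists>\<alpha>g>0. \<exists>\<alpha>H>0. \<exists>T::nat.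
           (\<epsilon>g \<le> 1 \<and> \<epsilon>H \<le> 1 \<longrightarrow> real T \<le> C * max (1 / \<epsilon>g ^ 2) (1 / \<epsilon>H ^ 3)) \<and>
           rgd_returns_within f \<epsilon>g \<epsilon>H \<alpha>g \<alpha>H h\<^sub>0 T (approx_second_order_stationary f \<epsilon>g \<epsilon>H)"
      using bound t K\<^sub>g by (intro exI[of _ "1 / (2 * K\<^sub>g)"] exI[of _ t] exI[of _ T] conjI impI) auto
  qed
qed

end

section \<open>Square roots of quadratic forms\<close>

lemma sqrt_le_tangent:
  fixes s u :: real
  assumes "s > 0" "u \<ge> 0"
  shows "sqrt u \<le> s + (u - s\<^sup>2) / (2 * s)"
proof -
  define w where "w = sqrt u"
  have u: "u = w\<^sup>2" using assms by (simp add: w_def)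
  have "s + (w\<^sup>2 - s\<^sup>2) / (2 * s) - w = (w - s)\<^sup>2 / (2 * s)"
    using assms by (simp add: field_simps power2_eq_square)
  also have "\<dots> \<ge> 0" using assms by simp
  finally show ?thesis unfolding w_def[symmetric] by (simp add: u)
qed

text \<open>
  The Taylor polynomials of odd degree lie above the square root because its even derivatives are
  negative.  With \<open>w = sqrt u\<close> the difference factors into the nonnegative expression in the proof,
  so the bound holds far away from \<open>s\<^sup>2\<close> too.
\<close>

lemma sqrt_le_taylor3:
  fixes s u :: real
  assumes "s > 0" "u \<ge> 0"
  defines "x \<equiv> u - s\<^sup>2"
  shows "sqrt u \<le> s + x / (2 * s) - x\<^sup>2 / (8 * s ^ 3) + x ^ 3 / (16 * s ^ 5)"
proof -
  define w where "w = sqrt u"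
  have u: "u = w\<^sup>2" and w: "w \<ge> 0" using assms by (auto simp: w_def)
  have "s + x / (2 * s) - x\<^sup>2 / (8 * s ^ 3) + x ^ 3 / (16 * s ^ 5) - w
      = (w - s) ^ 4 * (w\<^sup>2 + 4 * w * s + 5 * s\<^sup>2) / (16 * s ^ 5)"
    using assms(1) unfolding x_def u by (simp add: field_simps) algebra
  also have "\<dots> \<ge> 0" using assms w by simp
  finally show ?thesis unfolding w_def[symmetric] by simp
qed

definition sqrt_form :: "real ^ 'n ^ 'n \<Rightarrow> real \<Rightarrow> real ^ 'n \<Rightarrow> real" where
  "sqrt_form B \<epsilon> x = sqrt (x \<bullet> (B *v x) + \<epsilon>)"

lemma sqrt_form_pos: "pos_semidef B \<Longrightarrow> \<epsilon> > 0 \<Longrightarrow> sqrt_form B \<epsilon> x > 0"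
  by (simp add: sqrt_form_def pos_semidef_def add_nonneg_pos)

lemma quadratic_form_normalize:
  fixes h v :: "real ^ 'n"
  assumes B: "pos_semidef B" and h: "norm h = 1" and v: "norm v = 1" "h \<bullet> v = 0"
  shows "normalize_vec (h + t *\<^sub>R v) \<bullet> (B *v normalize_vec (h + t *\<^sub>R v))
    = (h \<bullet> (B *v h) + 2 * t * (v \<bullet> (B *v h)) + t\<^sup>2 * (v \<bullet> (B *v v))) / (1 + t\<^sup>2)"
proof -
  define z where "z = h + t *\<^sub>R v"
  have sym: "h \<bullet> (B *v v) = v \<bullet> (B *v h)"
    using B by (intro symmetric_matrix_inner_commute) (simp add: pos_semidef_def)
  have "normalize_vec z \<bullet> (B *v normalize_vec z) = (z \<bullet> (B *v z)) / (norm z)\<^sup>2"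
    by (simp add: normalize_vec_def matrix_vector_mult_scaleR power2_eq_square divide_inverse)
  moreover have "z \<bullet> (B *v z) = h \<bullet> (B *v h) + 2 * t * (v \<bullet> (B *v h)) + t\<^sup>2 * (v \<bullet> (B *v v))"
    by (simp add: z_def matrix_vector_right_distrib matrix_vector_mult_scaleR inner_add_left
        inner_add_right sym power2_eq_square algebra_simps)
  ultimately show ?thesis
    unfolding z_def norm_tangent_step[OF h v] by simp
qed

text \<open>
  Both expansions below are the bounds for the square root, applied to the values of the form along
  the curve; \<open>M\<close> bounds the bilinear form on unit vectors.  In the first one the step length
  is not restricted, so that it also covers gradient steps at points with a large gradient.
\<close>

lemma sqrt_form_first_order:
  fixes h v :: "real ^ 'n"
  assumes B: "pos_semidef B" and \<epsilon>: "\<epsilon> > 0"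
    and M: "M \<ge> 0" "\<And>x z. norm x = 1 \<Longrightarrow> norm z = 1 \<Longrightarrow> \<bar>x \<bullet> (B *v z)\<bar> \<le> M"
    and h: "norm h = 1" and v: "norm v = 1" "h \<bullet> v = 0" and t: "t \<ge> 0"
  shows "sqrt_form B \<epsilon> (normalize_vec (h + t *\<^sub>R v))
    \<le> sqrt_form B \<epsilon> h + t * ((v \<bullet> (B *v h)) / sqrt_form B \<epsilon> h) + M / sqrt \<epsilon> * t\<^sup>2"
proof -
  define a b c where "a = h \<bullet> (B *v h)" and "b = v \<bullet> (B *v h)" and "c = v \<bullet> (B *v v)"
  define s where "s = sqrt_form B \<epsilon> h"
  define q where "q = (a + 2 * t * b + t\<^sup>2 * c) / (1 + t\<^sup>2)"
  have a: "a \<ge> 0" using B by (simp add: a_def pos_semidef_def)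
  have s: "s > 0" "s\<^sup>2 = a + \<epsilon>" "s \<ge> sqrt \<epsilon>"
    using a \<epsilon> by (auto simp: s_def sqrt_form_def a_def[symmetric])
  have bc: "\<bar>b\<bar> \<le> M" "c \<le> M"
    using M(2)[OF v(1) h] M(2)[OF v(1) v(1)] by (auto simp: b_def c_def)
  have q: "normalize_vec (h + t *\<^sub>R v) \<bullet> (B *v normalize_vec (h + t *\<^sub>R v)) = q"
    unfolding q_def a_def b_def c_def by (rule quadratic_form_normalize[OF B h v])
  have "q \<ge> 0" using B unfolding q[symmetric] pos_semidef_def by blast
  have tpos: "1 + t\<^sup>2 > 0" by (simp add: add_pos_nonneg)
  have "q - a - 2 * b * t = ((c - a) * t\<^sup>2 - 2 * b * t ^ 3) / (1 + t\<^sup>2)"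
    using tpos by (simp add: q_def field_simps power2_eq_square power3_eq_cube)
  also have "\<dots> \<le> 2 * M * t\<^sup>2"
  proof -
    have "(c - a) * t\<^sup>2 \<le> M * t\<^sup>2" using bc a by (intro mult_right_mono) auto
    moreover have "- 2 * b * t ^ 3 \<le> 2 * M * t ^ 3"
      using bc t by (intro mult_right_mono) auto
    moreover have "2 * M * t ^ 3 \<le> M * t\<^sup>2 * (1 + t\<^sup>2)"
    proof -
      \<comment> \<open>This is \<open>2 t \<le> 1 + t\<^sup>2\<close>.\<close>
      have "0 \<le> M * t\<^sup>2 * (1 - t)\<^sup>2" using M by simp
      then show ?thesis by (simp add: algebra_simps power2_eq_square power3_eq_cube)
    qed
    moreover have "0 \<le> M * t\<^sup>2 * t\<^sup>2" using M by simp
    moreover have "2 * M * t\<^sup>2 * (1 + t\<^sup>2) = M * t\<^sup>2 + M * t\<^sup>2 * t\<^sup>2 + M * t\<^sup>2 * (1 + t\<^sup>2)"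
      by (simp add: distrib_left)
    ultimately have "(c - a) * t\<^sup>2 - 2 * b * t ^ 3 \<le> 2 * M * t\<^sup>2 * (1 + t\<^sup>2)"
      by linarith
    then show ?thesis using tpos by (simp add: pos_divide_le_eq)
  qed
  finally have x: "q + \<epsilon> - s\<^sup>2 \<le> 2 * b * t + 2 * M * t\<^sup>2" using s by simp
  have "sqrt (q + \<epsilon>) \<le> s + (q + \<epsilon> - s\<^sup>2) / (2 * s)"
    using s \<open>q \<ge> 0\<close> \<epsilon> by (intro sqrt_le_tangent) auto
  also have "\<dots> \<le> s + (2 * b * t + 2 * M * t\<^sup>2) / (2 * s)"
    using x s by (intro add_left_mono divide_right_mono) auto
  also have "\<dots> = s + t * (b / s) + M / s * t\<^sup>2" using s by (simp add: field_simps)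
  also have "M / s * t\<^sup>2 \<le> M / sqrt \<epsilon> * t\<^sup>2"
    using s \<epsilon> M by (intro mult_right_mono divide_left_mono) auto
  finally show ?thesis by (simp add: s_def b_def sqrt_form_def[of B \<epsilon> "normalize_vec _"] q)
qed

text \<open>
  The increment \<open>x\<close> of the form is \<open>2 b t + (c - a) t\<^sup>2\<close> up to an error of order \<open>t\<^sup>3\<close>.  The linear
  term of the cubic bound contributes the first- and second-order coefficients, the square
  contributes \<open>- b\<^sup>2 / s\<^sup>3\<close>, and everything else is of order \<open>t\<^sup>3\<close>.
\<close>

lemma sqrt_form_second_order:
  fixes h v :: "real ^ 'n"
  assumes B: "pos_semidef B" and \<epsilon>: "\<epsilon> > 0"
    and M: "M \<ge> 0" "\<And>x z. norm x = 1 \<Longrightarrow> norm z = 1 \<Longrightarrow> \<bar>x \<bullet> (B *v z)\<bar> \<le> M"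
    and h: "norm h = 1" and v: "norm v = 1" "h \<bullet> v = 0" and t: "t \<ge> 0" "t \<le> 1"
  defines "s \<equiv> sqrt_form B \<epsilon> h"
  shows "sqrt_form B \<epsilon> (normalize_vec (h + t *\<^sub>R v))
    \<le> s + t * ((v \<bullet> (B *v h)) / s)
      + t\<^sup>2 / 2 * ((v \<bullet> (B *v v)) / s - (v \<bullet> (B *v h))\<^sup>2 / s ^ 3 - (h \<bullet> (B *v h)) / s)
      + (3 * M / (2 * sqrt \<epsilon>) + 5 * M\<^sup>2 / (2 * sqrt \<epsilon> ^ 3) + 27 * M ^ 3 / (16 * sqrt \<epsilon> ^ 5)) * t ^ 3"
proof -
  define a b c where "a = h \<bullet> (B *v h)" and "b = v \<bullet> (B *v h)" and "c = v \<bullet> (B *v v)"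
  define q where "q = (a + 2 * t * b + t\<^sup>2 * c) / (1 + t\<^sup>2)"
  define x where "x = q - a"
  have a: "a \<ge> 0" "c \<ge> 0" using B by (auto simp: a_def c_def pos_semidef_def)
  have s: "s > 0" "s\<^sup>2 = a + \<epsilon>" "s \<ge> sqrt \<epsilon>"
    using a(1) \<epsilon> unfolding s_def sqrt_form_def a_def[symmetric] by auto
  have M': "\<bar>b\<bar> \<le> M" "c \<le> M" "a \<le> M"
    unfolding a_def b_def c_def
    using M(2)[OF v(1) h] abs_le_D1[OF M(2)[OF v(1) v(1)]] abs_le_D1[OF M(2)[OF h h]] by blast+
  have q: "normalize_vec (h + t *\<^sub>R v) \<bullet> (B *v normalize_vec (h + t *\<^sub>R v)) = q"
    unfolding q_def a_def b_def c_def by (rule quadratic_form_normalize[OF B h v])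
  have "q \<ge> 0" using B unfolding q[symmetric] pos_semidef_def by blast
  have tpos: "1 + t\<^sup>2 > 0" by (simp add: add_pos_nonneg)
  have x_eq: "x * (1 + t\<^sup>2) = 2 * b * t + (c - a) * t\<^sup>2"
    using tpos by (simp add: x_def q_def field_simps power2_eq_square)
  have tt: "t\<^sup>2 \<le> t" using t by (simp add: power2_eq_square mult_left_le)
  have ca: "\<bar>(c - a) * t\<^sup>2\<bar> \<le> M * t\<^sup>2"
  proof -
    have "\<bar>c - a\<bar> \<le> M" using a M' by linarith
    then show ?thesis unfolding abs_mult abs_power2 by (rule mult_right_mono) simp
  qed
  have bt: "\<bar>2 * b * t\<bar> \<le> 2 * M * t"
    using mult_right_mono[OF M'(1) t(1)] t(1) by (simp add: abs_mult)
  have Mtt: "M * t\<^sup>2 \<le> M * t" using tt M by (simp add: mult_left_mono)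
  have x_abs: "\<bar>x\<bar> \<le> 3 * M * t"
  proof -
    have "\<bar>x\<bar> * 1 \<le> \<bar>x\<bar> * (1 + t\<^sup>2)" by (intro mult_left_mono) auto
    also have "\<dots> = \<bar>x * (1 + t\<^sup>2)\<bar>"
      by (simp only: abs_mult abs_of_pos[OF tpos])
    also have "\<dots> = \<bar>2 * b * t + (c - a) * t\<^sup>2\<bar>" by (simp only: x_eq)
    finally show ?thesis using ca bt Mtt by linarith
  qed
  have r: "\<bar>x - 2 * b * t - (c - a) * t\<^sup>2\<bar> \<le> 3 * M * t ^ 3"
  proof -
    have "x - 2 * b * t - (c - a) * t\<^sup>2 = - (x * t\<^sup>2)" using x_eq by (simp add: algebra_simps)
    then have "\<bar>x - 2 * b * t - (c - a) * t\<^sup>2\<bar> = \<bar>x\<bar> * t\<^sup>2" by (simp add: abs_mult)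
    also have "\<dots> \<le> 3 * M * t * t\<^sup>2" using x_abs by (intro mult_right_mono) auto
    finally show ?thesis by (simp add: power2_eq_square power3_eq_cube)
  qed
  have Mttt: "M * t ^ 3 \<le> M * t\<^sup>2" using t M by (intro mult_left_mono power_decreasing) auto
  have sq: "(2 * b * t)\<^sup>2 - x\<^sup>2 \<le> 20 * M\<^sup>2 * t ^ 3"
  proof -
    have "\<bar>2 * b * t - x\<bar> \<le> 4 * M * t\<^sup>2" using r ca Mttt by linarith
    moreover have "\<bar>2 * b * t + x\<bar> \<le> 5 * M * t" using x_abs bt by linarith
    ultimately have "\<bar>2 * b * t - x\<bar> * \<bar>2 * b * t + x\<bar> \<le> (4 * M * t\<^sup>2) * (5 * M * t)"
      using M by (intro mult_mono) auto
    moreover have "(2 * b * t)\<^sup>2 - x\<^sup>2 \<le> \<bar>2 * b * t - x\<bar> * \<bar>2 * b * t + x\<bar>"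
      unfolding abs_mult[symmetric] by (simp add: power2_eq_square algebra_simps)
    moreover have "(4 * M * t\<^sup>2) * (5 * M * t) = 20 * M\<^sup>2 * t ^ 3"
      by (simp add: power2_eq_square power3_eq_cube)
    ultimately show ?thesis by linarith
  qed
  have cube: "x ^ 3 \<le> 27 * M ^ 3 * t ^ 3"
  proof -
    have "x ^ 3 \<le> \<bar>x\<bar> ^ 3" by (simp flip: power_abs)
    also have "\<dots> \<le> (3 * M * t) ^ 3" using x_abs by (intro power_mono) auto
    finally show ?thesis by (simp add: power_mult_distrib)
  qed
  have "sqrt (q + \<epsilon>) \<le> s + x / (2 * s) - x\<^sup>2 / (8 * s ^ 3) + x ^ 3 / (16 * s ^ 5)"
    using sqrt_le_taylor3[of s "q + \<epsilon>"] s \<open>q \<ge> 0\<close> \<epsilon> by (simp add: x_def)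
  moreover have "x / (2 * s) \<le> (2 * b * t + (c - a) * t\<^sup>2 + 3 * M * t ^ 3) / (2 * s)"
    using r s by (intro divide_right_mono) auto
  moreover have "((2 * b * t)\<^sup>2 - 20 * M\<^sup>2 * t ^ 3) / (8 * s ^ 3) \<le> x\<^sup>2 / (8 * s ^ 3)"
    using sq s by (intro divide_right_mono) auto
  moreover have "x ^ 3 / (16 * s ^ 5) \<le> 27 * M ^ 3 * t ^ 3 / (16 * s ^ 5)"
    using cube s by (intro divide_right_mono) auto
  ultimately have "sqrt (q + \<epsilon>) \<le> s + (2 * b * t + (c - a) * t\<^sup>2 + 3 * M * t ^ 3) / (2 * s)
      - ((2 * b * t)\<^sup>2 - 20 * M\<^sup>2 * t ^ 3) / (8 * s ^ 3) + 27 * M ^ 3 * t ^ 3 / (16 * s ^ 5)"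
    by linarith
  also have "\<dots> = s + t * (b / s) + t\<^sup>2 / 2 * (c / s - b\<^sup>2 / s ^ 3 - a / s)
      + (3 * M / (2 * s) + 5 * M\<^sup>2 / (2 * s ^ 3) + 27 * M ^ 3 / (16 * s ^ 5)) * t ^ 3"
  proof -
    have "(2 * b * t + (c - a) * t\<^sup>2 + 3 * M * t ^ 3) / (2 * s)
        = t * (b / s) + t\<^sup>2 / 2 * (c / s - a / s) + 3 * M / (2 * s) * t ^ 3"
      using s(1) by (simp add: field_simps)
    moreover have "((2 * b * t)\<^sup>2 - 20 * M\<^sup>2 * t ^ 3) / (8 * s ^ 3)
        = t\<^sup>2 / 2 * (b\<^sup>2 / s ^ 3) - 5 * M\<^sup>2 / (2 * s ^ 3) * t ^ 3"
      using s(1) by (simp add: diff_divide_distrib power_mult_distrib mult_ac)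
    moreover have "27 * M ^ 3 * t ^ 3 / (16 * s ^ 5) = 27 * M ^ 3 / (16 * s ^ 5) * t ^ 3"
      by simp
    ultimately show ?thesis by (simp only: distrib_right right_diff_distrib)
  qed
  also have "(3 * M / (2 * s) + 5 * M\<^sup>2 / (2 * s ^ 3) + 27 * M ^ 3 / (16 * s ^ 5)) * t ^ 3
    \<le> (3 * M / (2 * sqrt \<epsilon>) + 5 * M\<^sup>2 / (2 * sqrt \<epsilon> ^ 3) + 27 * M ^ 3 / (16 * sqrt \<epsilon> ^ 5)) * t ^ 3"
  proof (intro mult_right_mono add_mono)
    have pows: "sqrt \<epsilon> ^ k \<le> s ^ k" "0 < s ^ k" "0 < sqrt \<epsilon> ^ k" for k
      using s \<epsilon> by (auto intro: power_mono)
    show "3 * M / (2 * s) \<le> 3 * M / (2 * sqrt \<epsilon>)"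
      using s \<epsilon> M(1) by (intro divide_left_mono) auto
    show "5 * M\<^sup>2 / (2 * s ^ 3) \<le> 5 * M\<^sup>2 / (2 * sqrt \<epsilon> ^ 3)"
      using pows[of 3] by (intro divide_left_mono) auto
    show "27 * M ^ 3 / (16 * s ^ 5) \<le> 27 * M ^ 3 / (16 * sqrt \<epsilon> ^ 5)"
      using pows[of 5] M(1) by (intro divide_left_mono) auto
  qed (use t in simp)
  finally show ?thesis by (simp add: b_def a_def c_def sqrt_form_def[of B \<epsilon> "normalize_vec _"] q)
qed

section \<open>Gradient and Hessian of a sum of square roots of forms\<close>

lemma gradient_eqI:
  assumes "GDERIV f x :> D"
  shows "gradient f x = D"
proof -
  have "D' = D" if "GDERIV f x :> D'" for D'
    using has_derivative_unique[of f "\<lambda>w. w \<bullet> D'" x "\<lambda>w. w \<bullet> D"] assms that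
    unfolding gderiv_def by (metis vector_eq_ldot)
  then show ?thesis unfolding gradient_def using assms by blast
qed

lemma has_derivative_sqrt_form:
  assumes B: "pos_semidef B" and \<epsilon>: "\<epsilon> > 0"
  shows "(sqrt_form B \<epsilon> has_derivative (\<lambda>w. (w \<bullet> (B *v x)) / sqrt_form B \<epsilon> x)) (at x)"
proof -
  have pos: "x \<bullet> (B *v x) + \<epsilon> > 0" using B \<epsilon> by (simp add: pos_semidef_def add_nonneg_pos)
  have sym: "x \<bullet> (B *v w) = w \<bullet> (B *v x)" for w
    using B by (intro symmetric_matrix_inner_commute) (simp add: pos_semidef_def)
  have "((\<lambda>x. x \<bullet> (B *v x) + \<epsilon>) has_derivative (\<lambda>w. x \<bullet> (B *v w) + w \<bullet> (B *v x))) (at x)"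
    by (auto intro!: derivative_eq_intros
        bounded_linear.has_derivative[OF matrix_vector_mul_bounded_linear])
  then have "((\<lambda>x. x \<bullet> (B *v x) + \<epsilon>) has_derivative (\<lambda>w. 2 * (w \<bullet> (B *v x)))) (at x)"
    by (simp only: sym mult_2)
  from has_derivative_real_sqrt[OF pos this] show ?thesis
    unfolding sqrt_form_def by (simp add: field_simps)
qed

lemma gradient_sum_sqrt_form:
  assumes "\<And>n. n \<in> I \<Longrightarrow> pos_semidef (B n)" "\<epsilon> > 0"
  shows "gradient (\<lambda>x. \<Sum>n\<in>I. sqrt_form (B n) \<epsilon> x) x = (\<Sum>n\<in>I. (B n *v x) /\<^sub>R sqrt_form (B n) \<epsilon> x)"
proof (rule gradient_eqI, unfold gderiv_def)
  show "((\<lambda>x. \<Sum>n\<in>I. sqrt_form (B n) \<epsilon> x) has_derivative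
     (\<lambda>w. w \<bullet> (\<Sum>n\<in>I. (B n *v x) /\<^sub>R sqrt_form (B n) \<epsilon> x))) (at x)"
    using has_derivative_sum[OF has_derivative_sqrt_form[OF assms], of I "\<lambda>n. n"]
    by (simp add: inner_sum_right divide_inverse mult.commute)
qed

lemma hessian_sum_sqrt_form:
  assumes "\<And>n. n \<in> I \<Longrightarrow> pos_semidef (B n)" "\<epsilon> > 0"
  shows "hessian (\<lambda>x. \<Sum>n\<in>I. sqrt_form (B n) \<epsilon> x) x *v w =
    (\<Sum>n\<in>I. (B n *v w) /\<^sub>R sqrt_form (B n) \<epsilon> x
       - ((w \<bullet> (B n *v x)) / sqrt_form (B n) \<epsilon> x ^ 3) *\<^sub>R (B n *v x))"
proof -
  define D where "D = (\<lambda>w. \<Sum>n\<in>I. (B n *v w) /\<^sub>R sqrt_form (B n) \<epsilon> x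
       - ((w \<bullet> (B n *v x)) / sqrt_form (B n) \<epsilon> x ^ 3) *\<^sub>R (B n *v x))"
  have "((\<lambda>x. (B n *v x) /\<^sub>R sqrt_form (B n) \<epsilon> x) has_derivative
      (\<lambda>w. (B n *v w) /\<^sub>R sqrt_form (B n) \<epsilon> x
       - ((w \<bullet> (B n *v x)) / sqrt_form (B n) \<epsilon> x ^ 3) *\<^sub>R (B n *v x))) (at x)" if "n \<in> I" for n
    using sqrt_form_pos[OF assms(1)[OF that] assms(2), of x]
    by (auto intro!: derivative_eq_intros has_derivative_sqrt_form[OF assms(1)[OF that] assms(2)]
        bounded_linear.has_derivative[OF matrix_vector_mul_bounded_linear]
        simp: field_simps power2_eq_square power3_eq_cube)
  then have "((\<lambda>x. \<Sum>n\<in>I. (B n *v x) /\<^sub>R sqrt_form (B n) \<epsilon> x) has_derivative D) (at x)"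
    unfolding D_def by (rule has_derivative_sum)
  moreover have "gradient (\<lambda>x. \<Sum>n\<in>I. sqrt_form (B n) \<epsilon> x)
      = (\<lambda>x. \<Sum>n\<in>I. (B n *v x) /\<^sub>R sqrt_form (B n) \<epsilon> x)"
    using gradient_sum_sqrt_form[of I B] assms by blast
  ultimately have der: "(gradient (\<lambda>x. \<Sum>n\<in>I. sqrt_form (B n) \<epsilon> x) has_derivative D) (at x)"
    by simp
  then have "hessian (\<lambda>x. \<Sum>n\<in>I. sqrt_form (B n) \<epsilon> x) x = matrix D"
    by (simp add: hessian_def jacobian_def frechet_derivative_at[symmetric])
  then show ?thesis
    using fun_cong[OF matrix_vector_mul(2)[OF has_derivative_linear[OF der]], of w] by (simp add: D_def)
qed

lemma matrix_form_bound:
  fixes B :: "real ^ 'n ^ 'n"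
  obtains M where "M \<ge> 0" "\<And>x z. norm x = 1 \<Longrightarrow> norm z = 1 \<Longrightarrow> \<bar>x \<bullet> (B *v z)\<bar> \<le> M"
proof
  show "onorm ((*v) B) \<ge> 0" by (intro onorm_pos_le matrix_vector_mul_bounded_linear)
  fix x z :: "real ^ 'n" assume "norm x = 1" "norm z = 1"
  then show "\<bar>x \<bullet> (B *v z)\<bar> \<le> onorm ((*v) B)"
    using Cauchy_Schwarz_ineq2[of x "B *v z"] onorm[OF matrix_vector_mul_bounded_linear[of B], of z]
    by simp
qed

lemma sum_sqrt_form_retraction_descent:
  fixes B :: "'i \<Rightarrow> real ^ 'n ^ 'n"
  assumes B: "\<And>n. n \<in> I \<Longrightarrow> pos_semidef (B n)" and \<epsilon>: "\<epsilon> > 0" and dim: "CARD('n) \<ge> 2"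
  shows "\<exists>K\<^sub>g K\<^sub>H. retraction_descent (\<lambda>x. \<Sum>n\<in>I. sqrt_form (B n) \<epsilon> x) 0 K\<^sub>g K\<^sub>H"
proof -
  have "\<forall>n. \<exists>M\<ge>0. \<forall>x z. norm x = 1 \<longrightarrow> norm z = 1 \<longrightarrow> \<bar>x \<bullet> (B n *v z)\<bar> \<le> M"
    by (metis matrix_form_bound)
  then obtain M where M: "\<And>n. M n \<ge> 0"
    "\<And>n x z. norm x = 1 \<Longrightarrow> norm z = 1 \<Longrightarrow> \<bar>x \<bullet> (B n *v z)\<bar> \<le> M n" by metis
  define k\<^sub>g where "k\<^sub>g = (\<lambda>n. M n / sqrt \<epsilon>)"
  define k\<^sub>H where "k\<^sub>H = (\<lambda>n. 3 * M n / (2 * sqrt \<epsilon>) + 5 * (M n)\<^sup>2 / (2 * sqrt \<epsilon> ^ 3)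
    + 27 * M n ^ 3 / (16 * sqrt \<epsilon> ^ 5))"
  define f where "f = (\<lambda>x. \<Sum>n\<in>I. sqrt_form (B n) \<epsilon> x)"
  have val: "f x = (\<Sum>n\<in>I. sqrt_form (B n) \<epsilon> x)" for x by (simp add: f_def)
  have grad: "gradient f x = (\<Sum>n\<in>I. (B n *v x) /\<^sub>R sqrt_form (B n) \<epsilon> x)" for x
    unfolding f_def by (intro gradient_sum_sqrt_form B \<epsilon>)
  have hess: "hessian f x *v w = (\<Sum>n\<in>I. (B n *v w) /\<^sub>R sqrt_form (B n) \<epsilon> x
       - ((w \<bullet> (B n *v x)) / sqrt_form (B n) \<epsilon> x ^ 3) *\<^sub>R (B n *v x))" for x w
    unfolding f_def by (intro hessian_sum_sqrt_form B \<epsilon>)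
  have "retraction_descent f 0 (1 + (\<Sum>n\<in>I. k\<^sub>g n)) (1 + (\<Sum>n\<in>I. k\<^sub>H n))"
  proof
    show "CARD('n) \<ge> 2" by (rule dim)
  next
    fix h u w :: "real ^ 'n"
    have "u \<bullet> (B n *v w) = w \<bullet> (B n *v u)" if "n \<in> I" for n
      using B[OF that] by (intro symmetric_matrix_inner_commute) (simp add: pos_semidef_def)
    then show "u \<bullet> (hessian f h *v w) = w \<bullet> (hessian f h *v u)"
      unfolding hess inner_sum_right by (intro sum.cong) (auto simp: inner_diff_right)
    show "0 \<le> f h" unfolding f_def by (intro sum_nonneg less_imp_le sqrt_form_pos B \<epsilon>)
  next
    show "1 \<le> 1 + (\<Sum>n\<in>I. k\<^sub>g n)" using M \<epsilon> by (simp add: k\<^sub>g_def sum_nonneg)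
    show "1 \<le> 1 + (\<Sum>n\<in>I. k\<^sub>H n)" using M \<epsilon> by (simp add: k\<^sub>H_def sum_nonneg)
  next
    fix h v :: "real ^ 'n" and t :: real
    assume hv: "norm h = 1" "norm v = 1" "h \<bullet> v = 0" and t: "0 \<le> t"
    have dgrad: "u \<bullet> gradient f h = (\<Sum>n\<in>I. (u \<bullet> (B n *v h)) / sqrt_form (B n) \<epsilon> h)" for u
      by (simp add: grad inner_sum_right divide_inverse mult.commute)
    have dhess: "v \<bullet> (hessian f h *v v) = (\<Sum>n\<in>I. (v \<bullet> (B n *v v)) / sqrt_form (B n) \<epsilon> h
        - (v \<bullet> (B n *v h))\<^sup>2 / sqrt_form (B n) \<epsilon> h ^ 3)"
      by (simp add: hess inner_sum_right inner_diff_right divide_inverse power2_eq_square mult_ac)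
    have "f (normalize_vec (h + t *\<^sub>R v)) \<le> (\<Sum>n\<in>I. sqrt_form (B n) \<epsilon> h
        + t * ((v \<bullet> (B n *v h)) / sqrt_form (B n) \<epsilon> h) + k\<^sub>g n * t\<^sup>2)"
      unfolding f_def k\<^sub>g_def by (intro sum_mono sqrt_form_first_order B \<epsilon> M hv t)
    also have "\<dots> = f h + t * (v \<bullet> gradient f h) + (\<Sum>n\<in>I. k\<^sub>g n) * t\<^sup>2"
      unfolding val dgrad by (simp only: sum.distrib sum_distrib_left sum_distrib_right)
    finally show "f (normalize_vec (h + t *\<^sub>R v))
        \<le> f h + t * (v \<bullet> gradient f h) + (1 + (\<Sum>n\<in>I. k\<^sub>g n)) * t\<^sup>2"
      unfolding distrib_right using zero_le_power2[of t] by linarith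
    assume t1: "t \<le> 1"
    have "f (normalize_vec (h + t *\<^sub>R v)) \<le> (\<Sum>n\<in>I. sqrt_form (B n) \<epsilon> h
        + t * ((v \<bullet> (B n *v h)) / sqrt_form (B n) \<epsilon> h)
        + t\<^sup>2 / 2 * ((v \<bullet> (B n *v v)) / sqrt_form (B n) \<epsilon> h
            - (v \<bullet> (B n *v h))\<^sup>2 / sqrt_form (B n) \<epsilon> h ^ 3 - (h \<bullet> (B n *v h)) / sqrt_form (B n) \<epsilon> h)
        + k\<^sub>H n * t ^ 3)"
      unfolding f_def k\<^sub>H_def by (intro sum_mono sqrt_form_second_order B \<epsilon> M hv t t1)
    also have "\<dots> = f h + t * (v \<bullet> gradient f h)
        + t\<^sup>2 / 2 * (v \<bullet> (hessian f h *v v) - h \<bullet> gradient f h) + (\<Sum>n\<in>I. k\<^sub>H n) * t ^ 3"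
      unfolding val dgrad dhess
      by (simp only: sum.distrib sum_subtractf sum_distrib_left sum_distrib_right right_diff_distrib)
    finally show "f (normalize_vec (h + t *\<^sub>R v)) \<le> f h + t * (v \<bullet> gradient f h)
        + t\<^sup>2 / 2 * (v \<bullet> (hessian f h *v v) - h \<bullet> gradient f h) + (1 + (\<Sum>n\<in>I. k\<^sub>H n)) * t ^ 3"
      unfolding distrib_right using zero_le_power[OF t, of 3] by linarith
  qed
  then show ?thesis unfolding f_def by blast
qed

lemma mean_square_form:
  fixes a :: "nat \<Rightarrow> real ^ 'n"
  obtains B where "pos_semidef B" "\<And>x. x \<bullet> (B *v x) = 1 / real L * (\<Sum>l = 1..L. (a l \<bullet> x)\<^sup>2)"
proof -
  define B :: "real ^ 'n ^ 'n" where "B = (\<chi> i j. 1 / real L * (\<Sum>l = 1..L. a l $ i * a l $ j))"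
  have Bx: "B *v x = (1 / real L) *\<^sub>R (\<Sum>l = 1..L. (a l \<bullet> x) *\<^sub>R a l)" for x
  proof (rule vec_eq_iff[THEN iffD2], rule allI)
    fix i
    have "(B *v x) $ i = 1 / real L * (\<Sum>j\<in>UNIV. (\<Sum>l = 1..L. a l $ i * a l $ j) * x $ j)"
      unfolding B_def matrix_vector_mult_def by (simp only: vec_lambda_beta mult.assoc) (simp only: sum_distrib_left)
    also have "(\<Sum>j\<in>UNIV. (\<Sum>l = 1..L. a l $ i * a l $ j) * x $ j)
        = (\<Sum>l = 1..L. (\<Sum>j\<in>UNIV. a l $ j * x $ j) * a l $ i)"
      unfolding sum_distrib_right by (subst sum.swap) (simp add: mult_ac)
    finally show "(B *v x) $ i = ((1 / real L) *\<^sub>R (\<Sum>l = 1..L. (a l \<bullet> x) *\<^sub>R a l)) $ i"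
      by (simp add: inner_vec_def)
  qed
  have form: "x \<bullet> (B *v x) = 1 / real L * (\<Sum>l = 1..L. (a l \<bullet> x)\<^sup>2)" for x
    unfolding Bx by (simp add: inner_sum_right power2_eq_square inner_commute)
  have "transpose B = B" by (simp add: B_def transpose_def vec_eq_iff mult.commute)
  then have "pos_semidef B" unfolding pos_semidef_def form by (simp add: sum_nonneg)
  with form that show thesis by blast
qed

theorem proposition8:
  fixes ix :: "'n::finite \<Rightarrow> nat"
    and L :: nat
    and y :: "nat \<Rightarrow> real ^ 'n"
    and \<epsilon> :: real
    and h\<^sub>0 :: "real ^ 'n"
  assumes "labelling ix"
    and "CARD('n) \<ge> 2"
    and "invertible (\<Sum>l = 1..L. transpose (circulant ix (y l)) ** circulant ix (y l))"
    and "\<epsilon> > 0"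
    and "h\<^sub>0 \<in> sphere 0 1"
  shows "\<exists>C>0. \<forall>\<epsilon>g>0. \<forall>\<epsilon>H>0. \<exists>\<alpha>g>0. \<exists>\<alpha>H>0. \<exists>T::nat.
           (\<epsilon>g \<le> 1 \<and> \<epsilon>H \<le> 1 \<longrightarrow> real T \<le> C * max (1 / \<epsilon>g ^ 2) (1 / \<epsilon>H ^ 3)) \<and>
           rgd_returns_within (rho ix L y \<epsilon>) \<epsilon>g \<epsilon>H \<alpha>g \<alpha>H h\<^sub>0 T
             (approx_second_order_stationary (rho ix L y \<epsilon>) \<epsilon>g \<epsilon>H)"
proof -
  define a where "a = (\<lambda>n l. transpose (Gamma_mat ix n ** precond ix L y) *v y l)"
  have a: "y l \<bullet> (Gamma_mat ix n *v (precond ix L y *v h)) = a n l \<bullet> h" for n l h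
    unfolding a_def by (simp add: matrix_vector_mul_assoc dot_lmul_matrix)
  have "\<exists>B. pos_semidef B \<and> (\<forall>x. x \<bullet> (B *v x) = 1 / real L * (\<Sum>l = 1..L. (a n l \<bullet> x)\<^sup>2))" for n
    using mean_square_form[of L "a n"] by blast
  then obtain B where B: "\<And>n. pos_semidef (B n)"
    "\<And>n x. x \<bullet> (B n *v x) = 1 / real L * (\<Sum>l = 1..L. (a n l \<bullet> x)\<^sup>2)" by metis
  have rho: "rho ix L y \<epsilon> = (\<lambda>h. \<Sum>n = 1..CARD('n). sqrt_form (B n) \<epsilon> h)"
    by (simp add: fun_eq_iff rho_def sqrt_form_def B(2) a)
  have "\<exists>K\<^sub>g K\<^sub>H. retraction_descent (rho ix L y \<epsilon>) 0 K\<^sub>g K\<^sub>H"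
    unfolding rho by (rule sum_sqrt_form_retraction_descent[where I = "{1..CARD('n)}" and B = B, OF B(1) assms(4,2)])
  then obtain K\<^sub>g K\<^sub>H where "retraction_descent (rho ix L y \<epsilon>) 0 K\<^sub>g K\<^sub>H" by blast
  then show ?thesis
    by (rule retraction_descent.rgd_complexity) (use assms(5) in simp)
qed

end
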